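(* Let $G$ be an Eulerian directed multigraph with $n$ vertices and $m$ edges, given (read-only) with fixed orderings of incoming and outgoing edges at each vertex. Algorithm \textsc{Space-Efficient-Hierholzer} (described in the context) uses $\mathrm{O}(n\lg m)$ bits of working space, i.e. auxiliary memory excluding the read-only input and the write-only output.
   Context: $G=(V,E)$ is a finite directed multigraph (loops and parallel edges allowed), $V=[n]$, $|E|=m$. $d^+(v)$, $d^-(v)$ are out- and in-degree. $G$ is Eulerian: strongly connected and $d^+(v)=d^-(v)$ for all $v$. $\Gamma^+(v,i)$ is the head of the $i$-th outgoing edge of $v$ and $\Gamma^-(v,i)$ the tail of the $i$-th incoming edge of $v$, w.r.t. arbitrary fixed orderings. Algorithm \textsc{Space-Efficient-Hierholzer}: initialise integer arrays $\texttt{next}[1..n]$, $B[1..n]$ and bit arrays $\texttt{visited}[1..n]$, $\texttt{skipped}[1..n]$ to all zeros and a counter $c\gets 0$. Pick an arbitrary $v_0\in[n]$, set $u\gets v_0$ and $\texttt{visited}[u]\gets 1$. While $c<m$: set $\texttt{next}[u]\gets\texttt{next}[u]+1$ and $i\gets\texttt{next}[u]$. If $i\le d^-(u)$: let $v\gets\Gamma^-(u,i)$; if $\texttt{visited}[v]=0$ then (if $v\ne v_0$ set $B[v]\gets u$) and set $\texttt{visited}[v]\gets 1$; then set $u\gets v$. Otherwise: set $i\gets \texttt{next}[u]-d^-(u)$; if $\Gamma^+(u,i)=B[u]$ and $\texttt{skipped}[u]=0$, then set $\texttt{skipped}[u]\gets 1$, $\texttt{next}[u]\gets\texttt{next}[u]+1$,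 $i\gets i+1$ (the test is taken to be false if $i>d^+(u)$). Then if $i>d^+(u)$ let $v\gets B[u]$, else $v\gets \Gamma^+(u,i)$; write the edge $uv$ to the output, set $c\gets c+1$ and $u\gets v$. *)

theory Defs
  imports
    "Graph_Theory.Graph_Theory"
    "HOL-Library.Extended_Nat"
    "HOL-Library.Extended_Real"
    "HOL-Library.Log_Nat"
begin

section \<open>Eulerian directed multigraphs and their edge orderings\<close>

definition eulerian_multigraph :: "('a, 'e) pre_digraph \<Rightarrow> bool" where
  "eulerian_multigraph G \<longleftrightarrow>
     fin_digraph G \<and> strongly_connected G \<and>
     (\<forall>v \<in> verts G. out_degree G v = in_degree G v)"

definition edge_orderings ::
  "('a, 'e) pre_digraph \<Rightarrow> ('a \<Rightarrow> 'e list) \<Rightarrow> ('a \<Rightarrow> 'e list) \<Rightarrow> bool" where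
  "edge_orderings G ins outs \<longleftrightarrow>
     (\<forall>v \<in> verts G. distinct (ins v) \<and> set (ins v) = in_arcs G v \<and>
                   distinct (outs v) \<and> set (outs v) = out_arcs G v)"

text \<open>Positions in the orderings are numbered from 1.\<close>

definition Gamma_in :: "('a, 'e) pre_digraph \<Rightarrow> ('a \<Rightarrow> 'e list) \<Rightarrow> 'a \<Rightarrow> nat \<Rightarrow> 'a" where
  "Gamma_in G ins v i = tail G (ins v ! (i - 1))"

definition Gamma_out :: "('a, 'e) pre_digraph \<Rightarrow> ('a \<Rightarrow> 'e list) \<Rightarrow> 'a \<Rightarrow> nat \<Rightarrow> 'a" where
  "Gamma_out G outs v i = head G (outs v ! (i - 1))"

section \<open>The algorithm\<close>

text \<open>
  The algorithm is a transition system with one control label per line of the following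
  pseudocode, so that the contents of every variable after every single assignment occur in
  some configuration of the run.

    While:       while c < m:
    Incr:          next[u] := next[u] + 1
    Fetch:         i := next[u]
    TestIn:        if i <= indeg(u):
    GetIn:           v := Gamma_in(u, i)
    TestVisited:     if visited[v] = 0:
    TestStart:         if v /= v0:
    SetB:                B[v] := u
    SetVisited:        visited[v] := 1
    GoBack:          u := v
                   else:
    Offset:          i := next[u] - indeg(u)
    TestSkip:        if i <= outdeg(u) and Gamma_out(u, i) = B[u] and skipped[u] = 0:
    SetSkipped:        skipped[u] := 1
    SkipNext:          next[u] := next[u] + 1
    SkipIdx:           i := i + 1
    GetOut:          if i > outdeg(u) then v := B[u] else v := Gamma_out(u, i)
    Write:           output the edge uv
    Count:           c := c + 1
    GoForth:         u := v
    Halt:        end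
\<close>

datatype label =
    While | Incr | Fetch | TestIn
  | GetIn | TestVisited | TestStart | SetB | SetVisited | GoBack
  | Offset | TestSkip | SetSkipped | SkipNext | SkipIdx
  | GetOut | Write | Count | GoForth
  | Halt

record config =
  pc      :: label
  nxt     :: "nat \<Rightarrow> nat"
  B       :: "nat \<Rightarrow> nat"
  visited :: "nat \<Rightarrow> bool"
  skipped :: "nat \<Rightarrow> bool"
  cnt     :: nat
  cur     :: nat
  nbr     :: nat
  idx     :: nat
  written :: "(nat \<times> nat) list"

text \<open>
  \<open>cnt\<close>, \<open>cur\<close>, \<open>nbr\<close>, \<open>idx\<close> are the scalars
  $c$, $u$, $v$, $i$; the field \<open>written\<close> is the write-only output.
\<close>

definition init :: "nat \<Rightarrow> config" where
  "init v0 = \<lparr> pc = While, nxt = (\<lambda>_. 0), B = (\<lambda>_. 0),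
     visited = (\<lambda>_. False)(v0 := True), skipped = (\<lambda>_. False),
     cnt = 0, cur = v0, nbr = 0, idx = 0, written = [] \<rparr>"

definition step ::
  "(nat, 'e) pre_digraph \<Rightarrow> (nat \<Rightarrow> 'e list) \<Rightarrow> (nat \<Rightarrow> 'e list) \<Rightarrow> nat \<Rightarrow> config \<Rightarrow> config" where
  "step G ins outs v0 s =
    (let u = cur s; v = nbr s; i = idx s in
     case pc s of
       While \<Rightarrow> s\<lparr>pc := if cnt s < card (arcs G) then Incr else Halt\<rparr>
     | Incr \<Rightarrow> s\<lparr>nxt := (nxt s)(u := nxt s u + 1), pc := Fetch\<rparr>
     | Fetch \<Rightarrow> s\<lparr>idx := nxt s u, pc := TestIn\<rparr>
     | TestIn \<Rightarrow> s\<lparr>pc := if i \<le> in_degree G u then GetIn else Offset\<rparr>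
     | GetIn \<Rightarrow> s\<lparr>nbr := Gamma_in G ins u i, pc := TestVisited\<rparr>
     | TestVisited \<Rightarrow> s\<lparr>pc := if \<not> visited s v then TestStart else GoBack\<rparr>
     | TestStart \<Rightarrow> s\<lparr>pc := if v \<noteq> v0 then SetB else SetVisited\<rparr>
     | SetB \<Rightarrow> s\<lparr>B := (B s)(v := u), pc := SetVisited\<rparr>
     | SetVisited \<Rightarrow> s\<lparr>visited := (visited s)(v := True), pc := GoBack\<rparr>
     | GoBack \<Rightarrow> s\<lparr>cur := v, pc := While\<rparr>
     | Offset \<Rightarrow> s\<lparr>idx := nxt s u - in_degree G u, pc := TestSkip\<rparr>
     | TestSkip \<Rightarrow> s\<lparr>pc := if i \<le> out_degree G u \<and> Gamma_out G outs u i = B s u \<and> \<not> skipped s u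
                          then SetSkipped else GetOut\<rparr>
     | SetSkipped \<Rightarrow> s\<lparr>skipped := (skipped s)(u := True), pc := SkipNext\<rparr>
     | SkipNext \<Rightarrow> s\<lparr>nxt := (nxt s)(u := nxt s u + 1), pc := SkipIdx\<rparr>
     | SkipIdx \<Rightarrow> s\<lparr>idx := i + 1, pc := GetOut\<rparr>
     | GetOut \<Rightarrow> s\<lparr>nbr := if i > out_degree G u then B s u else Gamma_out G outs u i, pc := Write\<rparr>
     | Write \<Rightarrow> s\<lparr>written := written s @ [(u, v)], pc := Count\<rparr>
     | Count \<Rightarrow> s\<lparr>cnt := cnt s + 1, pc := GoForth\<rparr>
     | GoForth \<Rightarrow> s\<lparr>cur := v, pc := While\<rparr>
     | Halt \<Rightarrow> s)"

definition run ::
  "(nat, 'e) pre_digraph \<Rightarrow> (nat \<Rightarrow> 'e list) \<Rightarrow> (nat \<Rightarrow> 'e list) \<Rightarrow> nat \<Rightarrow> config set" where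
  "run G ins outs v0 = range (\<lambda>k. (step G ins outs v0 ^^ k) (init v0))"

section \<open>Working space in bits\<close>

text \<open>The number of binary digits of a number; 0 still takes one bit.\<close>

definition bits :: "nat \<Rightarrow> nat" where
  "bits x = max 1 (floorlog 2 x)"

text \<open>The width of a memory cell that has to hold any value from a given set (infinite if that
  set is unbounded).\<close>

definition width :: "nat set \<Rightarrow> enat" where
  "width X = (SUP x\<in>X. enat (bits x))"

text \<open>
  Every variable gets a fixed width, sufficient throughout the whole run; all cells of an
  array have the same width, and the cells of the two bit arrays have width 1. The read-only input
  (the graph, its size, the degrees and the two edge orderings) and the write-only output are
  not charged. The arrays are charged with the cells \<open>0..n\<close> instead of
  \<open>1..n\<close>: the value 0 in \<open>B\<close> stands for an undefined entry, and including cell 0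
  ensures that every cell that could be addressed is charged, without presupposing that
  \<open>B[u]\<close> is defined whenever it is read.
\<close>

definition working_space ::
  "(nat, 'e) pre_digraph \<Rightarrow> (nat \<Rightarrow> 'e list) \<Rightarrow> (nat \<Rightarrow> 'e list) \<Rightarrow> nat \<Rightarrow> enat" where
  "working_space G ins outs v0 =
    (let n = card (verts G); S = run G ins outs v0; cells = enat (n + 1) in
       cells * width (\<Union>s\<in>S. nxt s ` {0..n}) +
       cells * width (\<Union>s\<in>S. B s ` {0..n}) +
       cells + cells +
       width (cnt ` S) + width (cur ` S) + width (nbr ` S) + width (idx ` S) +
       width {v0})"

end

theory Submission
  imports Defs
begin

text \<open>
  No correctness of the algorithm is needed: the space bound follows from a potential argument.
  An iteration either moves along an incoming edge, and then \<open>next[u] \<le> d\<^sup>-(u)\<close>, or it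
  raises \<open>next[u]\<close> by at most 2 while raising \<open>c\<close> by 1. Hence
  \<open>next[x] \<le> d\<^sup>-(x) + 2c\<close> for all \<open>x\<close> at the loop head, and \<open>c \<le> m\<close> because of the
  guard. Vertex names are at most \<open>n \<le> m\<close> by strong connectivity, so every cell holds a number
  that is \<open>O(m)\<close>.
\<close>

lemma (in fin_digraph) in_degree_le_card_arcs: "in_degree G v \<le> card (arcs G)"
  unfolding in_degree_def by (rule card_mono) auto

lemma (in wf_digraph) in_degree_eq_0_if_not_vert: "v \<notin> verts G \<Longrightarrow> in_degree G v = 0"
  unfolding in_degree_def in_arcs_def
  by (metis (mono_tags, lifting) card.empty empty_Collect_eq head_in_verts)

lemma (in wf_digraph) out_degree_eq_0_if_not_vert: "v \<notin> verts G \<Longrightarrow> out_degree G v = 0"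
  unfolding out_degree_def out_arcs_def
  by (metis (mono_tags, lifting) card.empty empty_Collect_eq tail_in_verts)

text \<open>With two vertices present, a walk from any \<open>v\<close> to another vertex starts
  with an arc, so \<open>tail\<close> maps the arcs onto the vertices. A single vertex may have no
  arcs at all.\<close>

lemma (in fin_digraph) card_verts_le_card_arcs:
  assumes "strongly_connected G" and "card (verts G) \<ge> 2"
  shows "card (verts G) \<le> card (arcs G)"
proof -
  have "v \<in> tail G ` arcs G" if v: "v \<in> verts G" for v
  proof -
    have "\<not> verts G \<subseteq> {v}"
      using assms(2) card_mono[of "{v}" "verts G"] by auto
    then obtain w where "w \<in> verts G" "w \<noteq> v" by auto
    then have "v \<rightarrow>\<^sup>* w"
      using assms(1) v by (auto simp: strongly_connected_def)
    then obtain x where "v \<rightarrow> x"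
      using \<open>w \<noteq> v\<close> by (auto elim: converse_reachable_cases)
    then show ?thesis by (auto simp: arcs_ends_def arc_to_ends_def)
  qed
  then have "verts G \<subseteq> tail G ` arcs G" by blast
  then have "card (verts G) \<le> card (tail G ` arcs G)"
    by (intro card_mono) auto
  also have "\<dots> \<le> card (arcs G)" by (rule card_image_le) simp
  finally show ?thesis .
qed

text \<open>The invariant admits \<open>u = 0\<close>, as \<open>B[u]\<close> might be undefined when it is read. This is
  harmless: vertex 0 has degree 0, so the positions read from the orderings are always valid.\<close>

lemma (in wf_digraph) Gamma_in_vert:
  assumes "edge_orderings G ins outs" and "1 \<le> i" and "i \<le> in_degree G u"
  shows "Gamma_in G ins u i \<in> verts G"
proof -
  have u: "u \<in> verts G"
    using assms in_degree_eq_0_if_not_vert[of u] by linarith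
  then have "length (ins u) = in_degree G u" and "set (ins u) = in_arcs G u"
    using assms(1) by (auto simp: edge_orderings_def in_degree_def dest!: distinct_card)
  then have "ins u ! (i - 1) \<in> in_arcs G u"
    using assms(2,3) nth_mem[of "i - 1" "ins u"] by simp
  then show ?thesis by (simp add: Gamma_in_def)
qed

lemma (in wf_digraph) Gamma_out_vert:
  assumes "edge_orderings G ins outs" and "1 \<le> i" and "i \<le> out_degree G u"
  shows "Gamma_out G outs u i \<in> verts G"
proof -
  have u: "u \<in> verts G"
    using assms out_degree_eq_0_if_not_vert[of u] by linarith
  then have "length (outs u) = out_degree G u" and "set (outs u) = out_arcs G u"
    using assms(1) by (auto simp: edge_orderings_def out_degree_def dest!: distinct_card)
  then have "outs u ! (i - 1) \<in> out_arcs G u"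
    using assms(2,3) nth_mem[of "i - 1" "outs u"] by simp
  then show ?thesis by (simp add: Gamma_out_def)
qed

text \<open>The amount by which \<open>next[u]\<close> may be ahead of \<open>d\<^sup>-(u) + 2c\<close> within an iteration.\<close>

definition slack :: "label \<Rightarrow> nat" where
  "slack l =
    (if l \<in> {Fetch, TestIn, Offset, TestSkip, SetSkipped, SkipNext} then 1
     else if l \<in> {SkipIdx, GetOut, Write, Count} then 2 else 0)"

text \<open>The bound \<open>1 \<le> idx s\<close> keeps the truncated \<open>i - 1\<close> in
  \<open>Gamma_in\<close> and \<open>Gamma_out\<close> harmless. At \<open>Offset\<close>, the
  strict inequality makes the difference assigned to \<open>idx\<close> positive.\<close>

definition idx_inv :: "(nat, 'e) pre_digraph \<Rightarrow> config \<Rightarrow> bool" where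
  "idx_inv G s =
    (case pc s of
       Fetch \<Rightarrow> 1 \<le> nxt s (cur s)
     | TestIn \<Rightarrow> 1 \<le> idx s \<and> idx s = nxt s (cur s)
     | GetIn \<Rightarrow> 1 \<le> idx s \<and> idx s \<le> in_degree G (cur s)
     | Offset \<Rightarrow> in_degree G (cur s) < nxt s (cur s)
     | TestSkip \<Rightarrow> 1 \<le> idx s \<and> idx s \<le> nxt s (cur s)
     | SetSkipped \<Rightarrow> 1 \<le> idx s \<and> idx s \<le> nxt s (cur s)
     | SkipNext \<Rightarrow> 1 \<le> idx s \<and> idx s \<le> nxt s (cur s)
     | SkipIdx \<Rightarrow> 1 \<le> idx s \<and> idx s + 1 \<le> nxt s (cur s)
     | GetOut \<Rightarrow> 1 \<le> idx s
     | _ \<Rightarrow> True)"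

definition hierholzer_inv :: "(nat, 'e) pre_digraph \<Rightarrow> config \<Rightarrow> bool" where
  "hierholzer_inv G s \<longleftrightarrow>
     (\<forall>x. nxt s x \<le> in_degree G x + 2 * cnt s + (if x = cur s then slack (pc s) else 0)) \<and>
     (if pc s \<in> {While, GoForth, Halt} then cnt s \<le> card (arcs G) else cnt s < card (arcs G)) \<and>
     (\<forall>x. B s x \<le> card (verts G)) \<and> cur s \<le> card (verts G) \<and> nbr s \<le> card (verts G) \<and>
     idx s \<le> 3 * card (arcs G) \<and> idx_inv G s"

lemma hierholzer_inv_nxt_le:
  assumes "fin_digraph G" and "hierholzer_inv G s"
  shows "nxt s x \<le> 3 * card (arcs G)"
proof -
  interpret fin_digraph G by fact
  have "nxt s x \<le> in_degree G x + 2 * cnt s + (if x = cur s then slack (pc s) else 0)"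
    using assms(2) unfolding hierholzer_inv_def by blast
  then have "nxt s x \<le> in_degree G x + 2 * cnt s + slack (pc s)"
    by (simp split: if_splits)
  moreover have "2 * cnt s + slack (pc s) \<le> 2 * card (arcs G)"
    using assms(2) unfolding hierholzer_inv_def slack_def by (auto split: if_splits)
  ultimately show ?thesis using in_degree_le_card_arcs[of x] by linarith
qed

lemma hierholzer_inv_init:
  "v0 \<le> card (verts G) \<Longrightarrow> hierholzer_inv G (init v0)"
  by (simp add: hierholzer_inv_def idx_inv_def init_def)

text \<open>Slack is discharged at two places: entering \<open>GetIn\<close>, where
  \<open>next[u]\<close> equals an index of at most the in-degree, and at \<open>Count\<close>,
  where \<open>2 * cnt\<close> grows by 2.\<close>

lemma hierholzer_inv_step:
  assumes fin: "fin_digraph G" and V: "verts G = {1..n}" and ord: "edge_orderings G ins outs"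
    and inv: "hierholzer_inv G s"
  shows "hierholzer_inv G (step G ins outs v0 s)"
proof -
  interpret fin_digraph G by fact
  note nxt_le = hierholzer_inv_nxt_le[OF fin inv]
  have in_le: "Gamma_in G ins u i \<le> n" if "1 \<le> i" "i \<le> in_degree G u" for u i
    using Gamma_in_vert[OF ord that] V by simp
  have out_le: "Gamma_out G outs u i \<le> n" if "1 \<le> i" "i \<le> out_degree G u" for u i
    using Gamma_out_vert[OF ord that] V by simp
  \<comment> \<open>Here \<open>next[u]\<close> has already been raised, so it dominates the raised
    index too.\<close>
  have idx_Suc: "Suc (idx s) \<le> 3 * card (arcs G)" if "pc s = SkipIdx"
    using inv nxt_le[of "cur s"] that by (auto simp: hierholzer_inv_def idx_inv_def)
  \<comment> \<open>Only these two labels change \<open>cur\<close>, the vertex that carries the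
    slack; the slack is 0 both there and at \<open>While\<close>.\<close>
  consider (GoBack) "pc s = GoBack" | (GoForth) "pc s = GoForth"
    | (stay) "pc s \<noteq> GoBack" "pc s \<noteq> GoForth"
    by blast
  then show ?thesis
  proof cases
    case GoBack
    then show ?thesis
      by (cases "nbr s = cur s")
        (use inv in \<open>auto simp: step_def hierholzer_inv_def idx_inv_def slack_def Let_def
            split: if_splits\<close>)
  next
    case GoForth
    then show ?thesis
      by (cases "nbr s = cur s")
        (use inv in \<open>auto simp: step_def hierholzer_inv_def idx_inv_def slack_def Let_def
            split: if_splits\<close>)
  next
    case stay
    then show ?thesis
      by (cases "pc s")
        (use inv nxt_le[of "cur s"] idx_Suc V in
          \<open>auto simp: step_def hierholzer_inv_def idx_inv_def slack_def Let_def
              intro!: in_le out_le split: if_splits\<close>)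
  qed
qed

lemma bits_mono: "x \<le> y \<Longrightarrow> bits x \<le> bits y"
  unfolding bits_def by (intro max.mono floorlog_mono) auto

lemma width_le: "(\<And>x. x \<in> X \<Longrightarrow> x \<le> b) \<Longrightarrow> width X \<le> enat (bits b)"
  unfolding width_def by (intro SUP_least) (simp add: bits_mono)

text \<open>The width is at most \<open>log 2 m + 3\<close>, and \<open>m \<ge> 2\<close> makes the
  logarithm at least 1, which absorbs the 3.\<close>

lemma bits_4_mult_le:
  assumes "m \<ge> 2"
  shows "real (bits (4 * m)) \<le> 4 * log 2 (real m)"
proof -
  have "1 \<le> log 2 (real m)" using assms by (simp add: le_log_iff)
  moreover have "real (floorlog 2 (4 * m)) \<le> log 2 (real (4 * m)) + 1"
    using assms by (simp add: floorlog_def)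
  moreover have "log 2 (real (4 * m)) = log 2 (real m) + 2"
    using assms log_pow_cancel[of 2 2] by (simp add: log_mult)
  ultimately show ?thesis unfolding bits_def by linarith
qed

lemma working_space_le:
  assumes fin: "fin_digraph G" and V: "verts G = {1..n}" and ord: "edge_orderings G ins outs"
    and v0: "v0 \<in> verts G" and nm: "n \<le> card (arcs G)"
  \<comment> \<open>One width serves all integer cells: values stay below \<open>3 * m\<close> or
    \<open>n \<le> m\<close>, and the factor is rounded up to 4 for an exact binary
    logarithm.\<close>
  defines "w \<equiv> bits (4 * card (arcs G))"
  shows "working_space G ins outs v0 \<le> enat (2 * (n + 1) * (w + 1) + 5 * w)"
proof -
  have inv: "hierholzer_inv G s" if "s \<in> run G ins outs v0" for s
  proof -
    have "hierholzer_inv G ((step G ins outs v0 ^^ k) (init v0))" for k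
      using v0 V by (induction k)
        (auto intro!: hierholzer_inv_init hierholzer_inv_step[OF fin V ord])
    then show ?thesis using that by (auto simp: run_def)
  qed
  have *: "nxt s x \<le> 4 * card (arcs G)" "B s x \<le> 4 * card (arcs G)" "cnt s \<le> 4 * card (arcs G)"
      "cur s \<le> 4 * card (arcs G)" "nbr s \<le> 4 * card (arcs G)" "idx s \<le> 4 * card (arcs G)"
    if "s \<in> run G ins outs v0" for s x
  proof -
    have *: "y \<le> card (verts G) \<Longrightarrow> y \<le> 4 * card (arcs G)" for y
      using nm V by simp
    show "nxt s x \<le> 4 * card (arcs G)"
      using hierholzer_inv_nxt_le[OF fin inv[OF that], of x] by simp
    show "B s x \<le> 4 * card (arcs G)" "cnt s \<le> 4 * card (arcs G)"
      "cur s \<le> 4 * card (arcs G)" "nbr s \<le> 4 * card (arcs G)" "idx s \<le> 4 * card (arcs G)"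
      using inv[OF that] by (auto simp: hierholzer_inv_def intro: * split: if_splits)
  qed
  let ?S = "run G ins outs v0"
  let ?w = "enat w" and ?c = "enat (n + 1)"
  have "working_space G ins outs v0 \<le>
      ?c * ?w + ?c * ?w + ?c + ?c + ?w + ?w + ?w + ?w + ?w"
    unfolding working_space_def Let_def w_def V card_atLeastAtMost diff_Suc_1
    by (intro add_mono mult_left_mono width_le order_refl)
      (use * v0 V nm in auto)
  also have "\<dots> = enat (2 * (n + 1) * (w + 1) + 5 * w)"
    by (simp add: algebra_simps)
  finally show ?thesis .
qed

theorem theorem13:
  shows "\<exists>C::real. C > 0 \<and>
    (\<forall>(G :: (nat, 'e) pre_digraph) (n::nat) (m::nat) ins outs v0.
       eulerian_multigraph G \<longrightarrow> verts G = {1..n} \<longrightarrow> card (arcs G) = m \<longrightarrow>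
       edge_orderings G ins outs \<longrightarrow> v0 \<in> verts G \<longrightarrow> m \<ge> 2 \<longrightarrow>
       ereal_of_enat (working_space G ins outs v0) \<le> ereal (C * (real n * log 2 (real m))))"
\<comment> \<open>With \<open>n \<ge> 1\<close> and \<open>L \<ge> 1\<close>, the arrays cost at
  most \<open>2 * (2 * n) * (5 * L)\<close> and the five scalars at most \<open>20 * n * L\<close>,
  together \<open>40 * n * L\<close>.\<close>
proof (intro exI[of _ 40] conjI allI impI)
  fix G :: "(nat, 'e) pre_digraph" and n m ins outs v0
  assume eul: "eulerian_multigraph G" and V: "verts G = {1..n}" and m: "card (arcs G) = m"
    and ord: "edge_orderings G ins outs" and v0: "v0 \<in> verts G" and m2: "m \<ge> 2"
  have fin: "fin_digraph G" and conn: "strongly_connected G"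
    using eul by (auto simp: eulerian_multigraph_def)
  \<comment> \<open>For \<open>n \<le> 1\<close> this comes from \<open>m \<ge> 2\<close> instead of
    connectivity.\<close>
  have "n \<le> m"
    using fin_digraph.card_verts_le_card_arcs[OF fin conn] V m m2 by (cases "n \<ge> 2") auto
  define w L where "w = bits (4 * m)" and "L = log 2 (real m)"
  have "working_space G ins outs v0 \<le> enat (2 * (n + 1) * (w + 1) + 5 * w)"
    using working_space_le[OF fin V ord v0] \<open>n \<le> m\<close> m by (simp add: w_def)
  then have "ereal_of_enat (working_space G ins outs v0)
      \<le> ereal_of_enat (enat (2 * (n + 1) * (w + 1) + 5 * w))"
    by (simp only: ereal_of_enat_le_iff)
  also have "\<dots> = ereal (2 * (real n + 1) * (real w + 1) + 5 * real w)"
    by (simp add: algebra_simps)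
  also have "2 * (real n + 1) * (real w + 1) + 5 * real w \<le> 40 * (real n * L)"
  proof -
    have w: "real w \<le> 4 * L" and L: "1 \<le> L"
      using bits_4_mult_le[OF m2] m2 by (simp_all add: w_def L_def le_log_iff)
    have n: "1 \<le> real n" using v0 V by simp
    have "2 * (real n + 1) * (real w + 1) \<le> 2 * (real n + real n) * (4 * L + L)"
      using n w L by (intro mult_mono) auto
    moreover have "5 * real w \<le> 20 * (real n * L)"
      using mult_right_mono[of 1 "real n" L] n w L by linarith
    ultimately show ?thesis by (simp add: algebra_simps)
  qed
  finally show "ereal_of_enat (working_space G ins outs v0)
      \<le> ereal (40 * (real n * log 2 (real m)))"
    by (simp add: L_def)
qed simp

end
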